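(* Let $n\ge1$ and $k\ge 1$. For tropical polynomials over $\mathbb{R}$ in $n$ variables, the minimal size of a universal testing set for polynomials with at most $k$ monomials is equal to $k$.
   Context: A tropical polynomial over $\mathbb{R}$ in $\vec{x}=(x_1,\dots,x_n)$ is a finite collection of tropical monomials $m_J(\vec{x}) = c_J + j_1x_1+\dots+j_nx_n$ with pairwise distinct exponent vectors $J=(j_1,\dots,j_n)$ of nonnegative integers and constants $c_J\in\mathbb{R}$; its value is $p(\vec{x})=\max_J m_J(\vec{x})$. It is nontrivial if it has at least one monomial. A point $\vec{a}\in\mathbb{R}^n$ is a root of $p$ if the maximum $\max_J m_J(\vec{a})$ is attained on at least two distinct monomials; otherwise it is a non-root. A universal testing set over $\mathbb{R}$ for tropical polynomials of $n$ variables with at most $k$ monomials is a finite set $S\subseteq\mathbb{R}^n$ such that every nontrivial tropical polynomial over $\mathbb{R}$ in $n$ variables with at most $k$ monomials has a non-root in $S$. *)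

theory Defs
  imports "HOL-Analysis.Analysis" "HOL-Library.Finite_Map"
begin

(* A tropical polynomial in variables indexed by 'n is a finite map sending each exponent vector J
   that occurs in it to its real constant c_J.  Being a map, it has pairwise distinct exponent
   vectors; an exponent vector outside the domain is an absent monomial (constant minus infinity). *)
type_synonym 'n trop_poly = "(nat ^ 'n, real) fmap"

definition exponents :: "('n::finite) trop_poly \<Rightarrow> (nat ^ 'n) set" where
  "exponents p = fmdom' p"

definition monomial_value :: "('n::finite) trop_poly \<Rightarrow> nat ^ 'n \<Rightarrow> real ^ 'n \<Rightarrow> real" where
  "monomial_value p J x = the (fmlookup p J) + (\<Sum>i\<in>UNIV. real (J $ i) * x $ i)"

(* Unspecified for the empty polynomial, where Max is taken over the empty set. *)
definition trop_value :: "('n::finite) trop_poly \<Rightarrow> real ^ 'n \<Rightarrow> real" where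
  "trop_value p x = Max ((\<lambda>J. monomial_value p J x) ` exponents p)"

definition nontrivial :: "('n::finite) trop_poly \<Rightarrow> bool" where
  "nontrivial p \<longleftrightarrow> exponents p \<noteq> {}"

definition trop_root :: "('n::finite) trop_poly \<Rightarrow> real ^ 'n \<Rightarrow> bool" where
  "trop_root p a \<longleftrightarrow>
     (\<exists>J\<in>exponents p. \<exists>J'\<in>exponents p. J \<noteq> J' \<and>
        monomial_value p J a = trop_value p a \<and> monomial_value p J' a = trop_value p a)"

definition universal_testing_set :: "nat \<Rightarrow> (real ^ 'n::finite) set \<Rightarrow> bool" where
  "universal_testing_set k S \<longleftrightarrow>
     finite S \<and>
     (\<forall>p :: 'n trop_poly. nontrivial p \<and> card (exponents p) \<le> k \<longrightarrow> (\<exists>a\<in>S. \<not> trop_root p a))"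

end

theory Submission
  imports Defs
begin

text \<open>
  The upper bound comes from restricting to a line. If \<open>v\<close> has coordinates linearly independent
  over the rationals, distinct exponent vectors \<open>J\<close> have distinct slopes \<open>J \<cdot> v\<close> along the line
  \<open>\<real> v\<close>, so a polynomial with at most \<open>k\<close> monomials restricts to a maximum of at most \<open>k\<close> affine
  functions of one variable with pairwise distinct slopes. Such a maximum is convex and its slope
  strictly increases at every root, so there are at most \<open>k - 1\<close> roots
  (\<open>card_roots_on_line_less\<close>), and any \<open>k\<close> points of the line form a universal testing set.
  A suitable \<open>v\<close> exists because the vectors to be avoided lie on countably many hyperplanes
  (\<open>exists_separating_direction\<close>).

  The lower bound needs only one of the variables. Given a finite set \<open>S\<close>, let
  \<open>b\<^sub>0 < \<dots> < b\<^sub>m\<^sub>-\<^sub>1\<close> be the values that the chosen coordinate takes on \<open>S\<close>. The convex function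
  \<open>y \<mapsto> (\<Sum>l<m. max 0 (y - b\<^sub>l))\<close> has a kink at every \<open>b\<^sub>l\<close>, and it is the tropical polynomial
  with the \<open>m + 1\<close> monomials \<open>j y - (b\<^sub>0 + \<dots> + b\<^sub>j\<^sub>-\<^sub>1)\<close>. All of \<open>S\<close> consists of roots of it
  (\<open>exists_poly_vanishing_on\<close>), so a set with fewer than \<open>k\<close> points is not a testing set.
\<close>

lemma finite_exponents [simp]: "finite (exponents p)"
  by (simp add: exponents_def)

lemma monomial_value_le_trop_value:
  "J \<in> exponents p \<Longrightarrow> monomial_value p J x \<le> trop_value p x"
  by (simp add: trop_value_def)

lemma trop_rootI:
  assumes "J \<in> exponents p" "J' \<in> exponents p" "J \<noteq> J'"
    and "monomial_value p J a = monomial_value p J' a"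
    and "\<And>L. L \<in> exponents p \<Longrightarrow> monomial_value p L a \<le> monomial_value p J a"
  shows "trop_root p a"
proof -
  have "trop_value p a = monomial_value p J a"
    unfolding trop_value_def by (rule Max_eqI) (use assms in auto)
  then show ?thesis
    unfolding trop_root_def using assms by metis
qed

lemma exists_poly_with_coefficients:
  fixes c :: "nat ^ 'n::finite \<Rightarrow> real"
  assumes "finite E"
  obtains p :: "'n trop_poly" where "exponents p = E"
    and "\<And>J. J \<in> E \<Longrightarrow> the (fmlookup p J) = c J"
proof -
  obtain Js where Js: "set Js = E"
    using finite_list[OF assms] by blast
  define p where "p = fmap_of_list (map (\<lambda>J. (J, c J)) Js)"
  have lookup: "fmlookup p = (Some \<circ> c) |` E"
    by (simp add: p_def fmlookup_of_list map_of_map_restrict Js)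
  have "exponents p = E"
    by (auto simp: exponents_def fmlookup_dom'_iff lookup restrict_map_def split: if_splits)
  then show thesis
    by (rule that) (simp add: lookup)
qed

text \<open>For \<open>J \<noteq> J'\<close> the vectors \<open>v\<close> with \<open>J \<cdot> v = J' \<cdot> v\<close> form a hyperplane, which is a null set,
  and there are only countably many pairs \<open>(J, J')\<close>.\<close>

lemma exists_separating_direction:
  obtains v :: "real ^ 'n::finite"
  where "inj (\<lambda>J :: nat ^ 'n. \<Sum>i\<in>UNIV. real (J $ i) * v $ i)"
proof -
  define d :: "nat ^ 'n \<Rightarrow> nat ^ 'n \<Rightarrow> real ^ 'n"
    where "d J J' = (\<chi> i. real (J $ i) - real (J' $ i))" for J J'
  define bad where "bad = (\<Union>(J, J') \<in> {(J, J'). J \<noteq> J'}. {v. d J J' \<bullet> v = 0})"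
  have "negligible bad"
    unfolding bad_def
  proof (rule negligible_countable_Union)
    show "countable ((\<lambda>(J, J'). {v. d J J' \<bullet> v = 0}) ` {(J, J'). J \<noteq> J'})"
      by (intro countable_image countableI_type)
  next
    fix H assume "H \<in> (\<lambda>(J, J'). {v. d J J' \<bullet> v = 0}) ` {(J, J'). J \<noteq> J'}"
    then obtain J J' where "J \<noteq> J'" and H: "H = {v. d J J' \<bullet> v = 0}"
      by auto
    then have "d J J' \<noteq> 0"
      by (auto simp: d_def vec_eq_iff)
    then show "negligible H"
      unfolding H by (intro negligible_hyperplane) simp
  qed
  then obtain v where v: "v \<notin> bad"
    using non_negligible_UNIV by (metis UNIV_eq_I)
  have "inj (\<lambda>J :: nat ^ 'n. \<Sum>i\<in>UNIV. real (J $ i) * v $ i)"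
  proof (rule injI, rule ccontr)
    fix J J' :: "nat ^ 'n"
    assume eq: "(\<Sum>i\<in>UNIV. real (J $ i) * v $ i) = (\<Sum>i\<in>UNIV. real (J' $ i) * v $ i)"
      and "J \<noteq> J'"
    from eq have "d J J' \<bullet> v = 0"
      by (simp add: d_def inner_vec_def left_diff_distrib sum_subtractf)
    with v \<open>J \<noteq> J'\<close> show False
      by (auto simp: bad_def)
  qed
  then show thesis by (rule that)
qed

text \<open>At a root two maximal monomials meet; let \<open>up t\<close> be the steeper one. The slopes of maximal
  monomials grow weakly with \<open>t\<close>, hence those of \<open>up t\<close> grow strictly: \<open>up t\<close> is at most as steep as
  the flatter monomial at any later root. So \<open>up\<close> is injective, and it never takes the flattest
  exponent of all.\<close>

lemma card_roots_on_line_less: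
  fixes p :: "('n::finite) trop_poly" and v :: "real ^ 'n"
  assumes inj: "inj (\<lambda>J :: nat ^ 'n. \<Sum>i\<in>UNIV. real (J $ i) * v $ i)"
    and "nontrivial p"
    and roots: "\<And>t. t \<in> T \<Longrightarrow> trop_root p (t *\<^sub>R v)"
  shows "card T < card (exponents p)"
proof -
  define slope where "slope J = (\<Sum>i\<in>UNIV. real (J $ i) * v $ i)" for J :: "nat ^ 'n"
  have slope_inj: "slope J \<noteq> slope J'" if "J \<noteq> J'" for J J'
    using inj that by (auto simp: slope_def inj_def)
  have on_line: "monomial_value p J (t *\<^sub>R v) = the (fmlookup p J) + t * slope J" for J t
    by (simp add: monomial_value_def slope_def sum_distrib_left mult_ac)
  let ?maximal = "\<lambda>t J. J \<in> exponents p \<and> monomial_value p J (t *\<^sub>R v) = trop_value p (t *\<^sub>R v)"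
  have "\<exists>J. ?maximal t J \<and> (\<exists>J'. ?maximal t J' \<and> slope J' < slope J)" if "t \<in> T" for t
    using roots[OF that] slope_inj unfolding trop_root_def by (metis linorder_neqE)
  then obtain up where up: "\<And>t. t \<in> T \<Longrightarrow> ?maximal t (up t)"
    and flatter: "\<And>t. t \<in> T \<Longrightarrow> \<exists>J'. ?maximal t J' \<and> slope J' < slope (up t)"
    by metis
  have slope_mono: "slope J \<le> slope J'" if "?maximal t J" "?maximal t' J'" "t < t'" for t t' J J'
  proof -
    have "the (fmlookup p J') + t * slope J' \<le> the (fmlookup p J) + t * slope J"
      using that monomial_value_le_trop_value[of J' p "t *\<^sub>R v"] by (simp add: on_line)
    moreover have "the (fmlookup p J) + t' * slope J \<le> the (fmlookup p J') + t' * slope J'"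
      using that monomial_value_le_trop_value[of J p "t' *\<^sub>R v"] by (simp add: on_line)
    ultimately have "(t' - t) * slope J \<le> (t' - t) * slope J'"
      by (simp add: algebra_simps)
    with \<open>t < t'\<close> show ?thesis by simp
  qed
  have "slope (up t) < slope (up t')" if "t \<in> T" "t' \<in> T" "t < t'" for t t'
    using slope_mono up flatter that by (meson le_less_trans)
  then have "inj_on up T"
    by (intro linorder_inj_onI') force
  have "exponents p \<noteq> {}"
    using \<open>nontrivial p\<close> by (simp add: nontrivial_def)
  then obtain J0 where J0: "J0 \<in> exponents p" "\<And>J. J \<in> exponents p \<Longrightarrow> slope J0 \<le> slope J"
    using ex_is_arg_min_if_finite[OF finite_exponents, of p slope]
    by (auto simp: is_arg_min_linorder)
  have "up ` T \<subseteq> exponents p - {J0}"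
    using up flatter J0(2) by fastforce
  then have "card T \<le> card (exponents p - {J0})"
    using \<open>inj_on up T\<close> by (metis card_inj_on_le finite_Diff finite_exponents)
  also have "\<dots> < card (exponents p)"
    using J0(1) by (intro psubset_card_mono) auto
  finally show ?thesis .
qed

lemma exists_universal_testing_set:
  "\<exists>S :: (real ^ 'n::finite) set. universal_testing_set k S \<and> card S = k"
proof -
  obtain v :: "real ^ 'n" where inj: "inj (\<lambda>J :: nat ^ 'n. \<Sum>i\<in>UNIV. real (J $ i) * v $ i)"
    by (rule exists_separating_direction)
  have "v \<noteq> 0"
  proof
    assume "v = 0"
    then have "(0 :: nat ^ 'n) = 1"
      using inj by (simp add: inj_def)
    then show False by simp
  qed
  define T where "T = real ` {..<k}"
  have "card T = k"
    by (simp add: T_def card_image)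
  define S where "S = (\<lambda>t. t *\<^sub>R v) ` T"
  have "card S = k"
    using \<open>v \<noteq> 0\<close> \<open>card T = k\<close> by (simp add: S_def card_image inj_on_def)
  moreover have "universal_testing_set k S"
    unfolding universal_testing_set_def
  proof (intro conjI allI impI)
    show "finite S" by (simp add: S_def T_def)
  next
    fix p :: "'n trop_poly"
    assume "nontrivial p \<and> card (exponents p) \<le> k"
    then show "\<exists>a\<in>S. \<not> trop_root p a"
      using card_roots_on_line_less[OF inj, of p T] \<open>card T = k\<close> by (force simp: S_def)
  qed
  ultimately show ?thesis by blast
qed

text \<open>The increments \<open>b j - b l\<close> of these partial sums are nonnegative up to \<open>l = j\<close> and nonpositive
  from there on, so the sums rise until \<open>j\<close> and fall afterwards.\<close>

lemma sum_differences_le: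
  fixes b :: "nat \<Rightarrow> real"
  assumes mono: "\<And>l l'. l \<le> l' \<Longrightarrow> l' < m \<Longrightarrow> b l \<le> b l'"
    and "j < m" "i \<le> m"
  shows "(\<Sum>l<i. b j - b l) \<le> (\<Sum>l<j. b j - b l)"
proof (cases "i \<le> j")
  case True
  then show ?thesis
    using assms by (intro sum_mono2) auto
next
  case False
  then have "(\<Sum>l<i. b j - b l) = (\<Sum>l<j. b j - b l) + (\<Sum>l\<in>{j..<i}. b j - b l)"
    by (subst sum.union_disjoint[symmetric]) (auto intro!: sum.cong)
  moreover have "(\<Sum>l\<in>{j..<i}. b j - b l) \<le> 0"
    using assms by (intro sum_nonpos) auto
  ultimately show ?thesis by simp
qed

lemma exists_poly_vanishing_on:
  fixes S :: "(real ^ 'n::finite) set"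
  assumes "finite S"
  obtains p :: "'n trop_poly" where "nontrivial p" "card (exponents p) \<le> Suc (card S)"
    and "\<And>a. a \<in> S \<Longrightarrow> trop_root p a"
proof -
  fix r :: 'n
  define bs where "bs = sorted_list_of_set ((\<lambda>a. a $ r) ` S)"
  define m where "m = length bs"
  have set_bs: "set bs = (\<lambda>a. a $ r) ` S"
    using assms by (simp add: bs_def)
  have sorted: "bs ! l \<le> bs ! l'" if "l \<le> l'" "l' < m" for l l'
    using that by (auto simp: bs_def m_def intro!: sorted_nth_mono)
  have "m \<le> card S"
    by (simp add: m_def bs_def card_image_le assms)
  define E :: "(nat ^ 'n) set" where "E = axis r ` {..m}"
  have "finite E" by (simp add: E_def)
  then obtain p :: "'n trop_poly" where E: "exponents p = E"
    and coeff: "\<And>J. J \<in> E \<Longrightarrow> the (fmlookup p J) = - (\<Sum>l<J $ r. bs ! l)"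
    using exists_poly_with_coefficients[of E "\<lambda>J. - (\<Sum>l<J $ r. bs ! l)"] by blast
  have partial_sum: "monomial_value p (axis r j) a = (\<Sum>l<j. a $ r - bs ! l)" if "j \<le> m" for j a
  proof -
    have "(\<Sum>i\<in>UNIV. real (axis r j $ i) * a $ i) = (\<Sum>i\<in>UNIV. if i = r then real j * a $ i else 0)"
      by (intro sum.cong) (auto simp: axis_def)
    then show ?thesis
      using that coeff[of "axis r j"] by (simp add: monomial_value_def E_def sum_subtractf)
  qed
  show thesis
  proof (rule that)
    show "nontrivial p"
      by (simp add: nontrivial_def E E_def)
    have "card E \<le> Suc m"
      unfolding E_def using card_image_le[of "{..m}" "axis r :: nat \<Rightarrow> nat ^ 'n"] by simp
    then show "card (exponents p) \<le> Suc (card S)"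
      using \<open>m \<le> card S\<close> by (simp add: E)
  next
    fix a assume "a \<in> S"
    then obtain j where "j < m" and j: "a $ r = bs ! j"
      using set_bs by (metis image_eqI in_set_conv_nth m_def)
    show "trop_root p a"
    proof (rule trop_rootI)
      show "axis r j \<in> exponents p" "axis r (Suc j) \<in> exponents p"
        using \<open>j < m\<close> by (auto simp: E E_def)
      show "axis r j \<noteq> (axis r (Suc j) :: nat ^ 'n)"
        by (simp add: axis_eq_axis)
      show "monomial_value p (axis r j) a = monomial_value p (axis r (Suc j)) a"
        using \<open>j < m\<close> by (simp add: partial_sum j)
    next
      fix L assume "L \<in> exponents p"
      then obtain i where "i \<le> m" "L = axis r i"
        by (auto simp: E E_def)
      then show "monomial_value p L a \<le> monomial_value p (axis r j) a"
        using \<open>j < m\<close> sum_differences_le[of m "(!) bs" j i] sorted by (simp add: partial_sum j)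
    qed
  qed
qed

theorem theorem9:
  fixes k :: nat
  assumes "k \<ge> 1"
  shows "(\<exists>S :: (real ^ 'n::finite) set. universal_testing_set k S \<and> card S = k) \<and>
         (\<forall>S :: (real ^ 'n) set. universal_testing_set k S \<longrightarrow> k \<le> card S)"
proof (intro conjI allI impI)
  show "\<exists>S :: (real ^ 'n) set. universal_testing_set k S \<and> card S = k"
    by (rule exists_universal_testing_set)
next
  fix S :: "(real ^ 'n) set"
  assume S: "universal_testing_set k S"
  then have "finite S"
    by (simp add: universal_testing_set_def)
  then obtain p :: "'n trop_poly" where "nontrivial p" "card (exponents p) \<le> Suc (card S)"
    and "\<And>a. a \<in> S \<Longrightarrow> trop_root p a"
    using exists_poly_vanishing_on by blast
  then have "\<not> Suc (card S) \<le> k"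
    using S unfolding universal_testing_set_def by (meson le_trans)
  then show "k \<le> card S" by simp
qed

end
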